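(* Consider the explicit bi-Lagrangian structures $(\omega,\mathcal{F},\mathcal{G})$ on the nilpotent Lie algebras of dimension $2$, $4$ and $6$ listed in the context, and their canonical connections. (1) For all the listed examples in dimension $2$ and $4$ the canonical connection is flat. (2) In dimension $6$ the canonical connection is flat for $8$ of the listed examples, namely those on $A_6$, $L_3\oplus A_3$, $L_{5,2}\oplus A_1$, $L_{6,1}$, $L_{5,3}\oplus A_1$, $L_{6,4}$, $L_{6,5}$, $L_{6,9}$, and non-flat for the remaining $8$ listed examples, namely those on $L_3\oplus L_3$, $L_{6,2}$, $L_{6,6}$, $L_{6,10}$, $L_{6,11}$, $L_{6,12}$, $L_{5,4}\oplus A_1$, $L_{6,16}$. All the listed examples are Ricci-flat.
   Context: Let $\mathfrak{g}$ be a finite-dimensional real Lie algebra. A symplectic form on $\mathfrak{g}$ is a closed, non-degenerate $2$-form $\omega\in\Lambda^2\mathfrak{g}^*$. A bi-Lagrangian structure on $\mathfrak{g}$ consists of a symplectic form $\omega$ and two Lagrangian Lie subalgebras $\mathcal{F},\mathcal{G}\subset\mathfrak{g}$ with $\mathfrak{g}=\mathcal{F}\oplus\mathcal{G}$ as vector spaces. It corresponds to a left-invariant bi-Lagrangian structure on the simply connected Lie group of $\mathfrak{g}$; elements of $\mathfrak{g}$ are regarded as left-invariant vector fields. Canonical connection: write $X_F,X_G$ for the components of $X$ in $\mathcal{F},\mathcal{G}$. For $X,Y\in\mathfrak{g}$ let $D(X,Y)$ be the unique element with $i_{D(X,Y)}\omega=L_Xi_Y\omega$, i.e. $\omega(D(X,Y),Z)=-\omega(Y,[X,Z])$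 for all $Z\in\mathfrak{g}$. The canonical connection $\nabla$ is given by $\nabla_XY=D(X_F,Y)_F+[X_G,Y]_F$ for $Y\in\mathcal{F}$ and $\nabla_XY=D(X_G,Y)_G+[X_F,Y]_G$ for $Y\in\mathcal{G}$, extended linearly in $Y$. (It is the unique connection that preserves $\mathcal{F}$ and $\mathcal{G}$, makes $\omega$ parallel, and is torsion-free.) Its curvature is $R(X,Y)Z=\nabla_X\nabla_YZ-\nabla_Y\nabla_XZ-\nabla_{[X,Y]}Z$; flat means $R=0$. The Ricci curvature $\mathrm{Ric}(X,Y)$ is the trace of $Z\mapsto R(Z,X)Y$; Ricci-flat means $\mathrm{Ric}=0$. Notation: $e_1,\dots,e_n$ is a basis of $\mathfrak{g}$, $\alpha_1,\dots,\alpha_n$ the dual basis, $\alpha_{ij}=\alpha_i\wedge\alpha_j$, and brackets are encoded by $d\alpha_i(e_j,e_k)=-\alpha_i([e_j,e_k])$. Always $d\alpha_1=d\alpha_2=0$. $\{\dots\}$ denotes a basis of a subalgebra; the two subalgebras listed are $\mathcal{F}$, then $\mathcal{G}$. Dimension $2$: $A_2$ (abelian), $\omega=\alpha_{12}$, $\{e_1\},\{e_2\}$. Dimension $4$, listed as $(d\alpha_3,d\alpha_4)$; $\omega$; $\mathcal{F},\mathcal{G}$: $A_4$: $(0,0)$; $\alpha_{12}+\alpha_{34}$; $\{e_1,e_3\},\{e_2,e_4\}$. $L_3\oplus A_1$: $(0,\alpha_{12})$; $\alpha_{14}+\alpha_{23}$; $\{e_1,e_3\},\{e_2,e_4\}$.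 Dimension $6$, listed as $(d\alpha_3,d\alpha_4,d\alpha_5,d\alpha_6)$; $\omega$; $\mathcal{F},\mathcal{G}$: $A_6$: $(0,0,0,0)$; $\alpha_{12}+\alpha_{34}+\alpha_{56}$; $\{e_1,e_3,e_5\},\{e_2,e_4,e_6\}$. $L_3\oplus A_3$: $(0,0,0,\alpha_{12})$; $\alpha_{16}+\alpha_{23}+\alpha_{45}$; $\{e_1,e_3,e_4\},\{e_2,e_5,e_6\}$. $L_{5,2}\oplus A_1$: $(0,0,\alpha_{12},\alpha_{13})$; $\alpha_{15}+\alpha_{24}+\alpha_{36}$; $\{e_1,e_4,e_6\},\{e_2,e_3,e_5\}$. $L_3\oplus L_3$: $(0,0,\alpha_{12},\alpha_{34})$; $\alpha_{15}+\alpha_{24}+\alpha_{36}$; $\{e_1,e_4,e_6\},\{e_2,e_3,e_5\}$. $L_{6,1}$: $(0,0,\alpha_{12},\alpha_{13}+\alpha_{24})$; $\alpha_{16}+\alpha_{23}-\alpha_{45}$; $\{e_1,e_2,e_5\},\{e_3,e_4,e_6\}$. $L_{6,2}$: $(0,0,\alpha_{13}-\alpha_{24},\alpha_{14}+\alpha_{23})$; $\alpha_{16}+\alpha_{25}+\alpha_{34}$; $\{e_1,e_3,e_5\},\{e_1+e_2,e_4,e_5-e_6\}$. $L_{5,3}\oplus A_1$: $(0,0,\alpha_{12},\alpha_{15}+\alpha_{23})$; $\alpha_{16}+\alpha_{24}-\alpha_{35}$; $\{e_1,e_3,e_4\},\{e_2,e_5,e_6\}$. $L_{6,4}$: $(0,\alpha_{12},\alpha_{13},\alpha_{23})$;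 $\alpha_{16}+2\alpha_{25}+\alpha_{34}$; $\{e_1,e_2,e_4\},\{e_3,e_5,e_6\}$. $L_{6,5}$: $(0,\alpha_{12},\alpha_{13},\alpha_{14})$; $\alpha_{16}+\alpha_{25}+\alpha_{34}$; $\{e_1,e_3,e_5\},\{e_2,e_4,e_6\}$. $L_{6,6}$: $(0,\alpha_{12},\alpha_{13},\alpha_{24})$; $\alpha_{15}+\alpha_{25}-\alpha_{26}+\alpha_{34}$; $\{e_1-e_2,e_3,e_5\},\{e_1+e_5,e_4,e_6\}$. $L_{6,9}$: $(0,\alpha_{12},\alpha_{13},\alpha_{14}+\alpha_{23})$; $\alpha_{16}+2\alpha_{25}+\alpha_{34}$; $\{e_1,e_3,e_5\},\{e_2,e_4,e_6\}$. $L_{6,10}$: $(0,\alpha_{12},\alpha_{14},\alpha_{23}+\alpha_{24})$; $\alpha_{16}+\alpha_{25}-\alpha_{34}$; $\{e_1,e_4,e_5\},\{e_2-e_4,e_3+e_5,e_6\}$. $L_{6,11}$: $(0,\alpha_{12},\alpha_{14},\alpha_{13}+\alpha_{24})$; $\alpha_{16}+\alpha_{25}-\alpha_{26}-\alpha_{34}$; $\{e_1,e_4,e_5\},\{e_1+e_2-e_4,e_3+e_5,e_6\}$. $L_{6,12}$: $(0,\alpha_{12},\alpha_{14}+\alpha_{23},\alpha_{13}-\alpha_{24})$; $-\alpha_{15}+6\alpha_{26}+7\alpha_{34}$; $\{e_2,e_3,e_5\},\{e_2-2e_1,e_3-e_4,-3e_5+e_6\}$. $L_{5,4}\oplus A_1$: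 $(0,\alpha_{12},\alpha_{14},\alpha_{15})$; $\alpha_{13}+\alpha_{26}-\alpha_{45}$; $\{e_1,e_5,e_6\},\{e_2,e_3,e_4\}$. $L_{6,16}$: $(\alpha_{12},\alpha_{13},\alpha_{23},\alpha_{14})$; $\alpha_{15}+\alpha_{24}+\alpha_{26}-\alpha_{34}$; $\{e_1,e_4,e_6\},\{e_2,e_3,e_5\}$. *)

theory Defs
  imports "HOL-Analysis.Analysis" "HOL-Library.Function_Algebras"
begin

section \<open>Lie algebras and bi-Lagrangian structures\<close>

definition lie_algebra :: "('a::real_vector \<Rightarrow> 'a \<Rightarrow> 'a) \<Rightarrow> bool" where
  "lie_algebra br \<longleftrightarrow>
     bilinear br \<and> (\<forall>x. br x x = 0) \<and>
     (\<forall>x y z. br x (br y z) + br y (br z x) + br z (br x y) = 0)"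

fun lower_central_series :: "('a::real_vector \<Rightarrow> 'a \<Rightarrow> 'a) \<Rightarrow> nat \<Rightarrow> 'a set" where
  "lower_central_series br 0 = UNIV"
| "lower_central_series br (Suc k) = span {br x y | x y. y \<in> lower_central_series br k}"

definition nilpotent_lie_algebra :: "('a::real_vector \<Rightarrow> 'a \<Rightarrow> 'a) \<Rightarrow> bool" where
  "nilpotent_lie_algebra br \<longleftrightarrow> lie_algebra br \<and> (\<exists>k. lower_central_series br k = {0})"

definition lie_subalgebra :: "('a::real_vector \<Rightarrow> 'a \<Rightarrow> 'a) \<Rightarrow> 'a set \<Rightarrow> bool" where
  "lie_subalgebra br S \<longleftrightarrow> subspace S \<and> (\<forall>x\<in>S. \<forall>y\<in>S. br x y \<in> S)"

definition ext_deriv2 ::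
    "('a \<Rightarrow> 'a \<Rightarrow> 'a) \<Rightarrow> ('a \<Rightarrow> 'a \<Rightarrow> real) \<Rightarrow> 'a \<Rightarrow> 'a \<Rightarrow> 'a \<Rightarrow> real" where
  "ext_deriv2 br \<omega> x y z = - \<omega> (br x y) z + \<omega> (br x z) y - \<omega> (br y z) x"

definition symplectic_form ::
    "('a::real_vector \<Rightarrow> 'a \<Rightarrow> 'a) \<Rightarrow> ('a \<Rightarrow> 'a \<Rightarrow> real) \<Rightarrow> bool" where
  "symplectic_form br \<omega> \<longleftrightarrow>
     bilinear \<omega> \<and> (\<forall>x. \<omega> x x = 0) \<and>
     (\<forall>x y z. ext_deriv2 br \<omega> x y z = 0) \<and>
     (\<forall>x. (\<forall>y. \<omega> x y = 0) \<longrightarrow> x = 0)"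

definition lagrangian :: "('a::real_vector \<Rightarrow> 'a \<Rightarrow> real) \<Rightarrow> 'a set \<Rightarrow> bool" where
  "lagrangian \<omega> S \<longleftrightarrow> subspace S \<and> S = {x. \<forall>y\<in>S. \<omega> x y = 0}"

record 'a bilag =
  bracket :: "'a \<Rightarrow> 'a \<Rightarrow> 'a"
  omega :: "'a \<Rightarrow> 'a \<Rightarrow> real"
  subF :: "'a set"
  subG :: "'a set"

definition bi_lagrangian :: "'a::real_vector bilag \<Rightarrow> bool" where
  "bi_lagrangian S \<longleftrightarrow>
     lie_algebra (bracket S) \<and> symplectic_form (bracket S) (omega S) \<and>
     lie_subalgebra (bracket S) (subF S) \<and> lagrangian (omega S) (subF S) \<and>
     lie_subalgebra (bracket S) (subG S) \<and> lagrangian (omega S) (subG S) \<and>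
     subF S \<inter> subG S = {0} \<and> {x + y | x y. x \<in> subF S \<and> y \<in> subG S} = UNIV"


section \<open>The canonical connection and its curvature\<close>

definition compF :: "'a::real_vector bilag \<Rightarrow> 'a \<Rightarrow> 'a" where
  "compF S X = (THE u. u \<in> subF S \<and> X - u \<in> subG S)"

definition compG :: "'a::real_vector bilag \<Rightarrow> 'a \<Rightarrow> 'a" where
  "compG S X = (THE v. v \<in> subG S \<and> X - v \<in> subF S)"

text \<open>
  \<open>connD S X Y\<close> is the element \<open>V\<close> with \<open>i\<^sub>V \<omega> = L\<^sub>X i\<^sub>Y \<omega>\<close>, all arguments being left-invariant.
\<close>

definition connD :: "'a bilag \<Rightarrow> 'a \<Rightarrow> 'a \<Rightarrow> 'a" where
  "connD S X Y = (THE V. \<forall>Z. omega S V Z = - omega S Y (bracket S X Z))"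

text \<open>
  The sum of the two defining formulas, one for the F-component and one for the G-component of Y.
\<close>

definition canonical_connection :: "'a::real_vector bilag \<Rightarrow> 'a \<Rightarrow> 'a \<Rightarrow> 'a" where
  "canonical_connection S X Y =
     (compF S (connD S (compF S X) (compF S Y)) + compF S (bracket S (compG S X) (compF S Y))) +
     (compG S (connD S (compG S X) (compG S Y)) + compG S (bracket S (compF S X) (compG S Y)))"

definition curvature :: "'a::real_vector bilag \<Rightarrow> 'a \<Rightarrow> 'a \<Rightarrow> 'a \<Rightarrow> 'a" where
  "curvature S X Y Z =
     canonical_connection S X (canonical_connection S Y Z)
     - canonical_connection S Y (canonical_connection S X Z)
     - canonical_connection S (bracket S X Y) Z"

definition flat :: "'a::real_vector bilag \<Rightarrow> bool" where
  "flat S \<longleftrightarrow> (\<forall>X Y Z. curvature S X Y Z = 0)"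

definition ricci :: "(real ^ 'n) bilag \<Rightarrow> real ^ 'n \<Rightarrow> real ^ 'n \<Rightarrow> real" where
  "ricci S X Y = trace (matrix (\<lambda>Z. curvature S Z X Y))"

definition ricci_flat :: "(real ^ 'n) bilag \<Rightarrow> bool" where
  "ricci_flat S \<longleftrightarrow> (\<forall>X Y. ricci S X Y = 0)"


section \<open>The listed examples\<close>

text \<open>
  The Lie algebra is real ^ 'n with 'n one of the numeral types 2, 4, 6, whose indices are
  1, ..., n (the index n being 0 in the numeral type). Sums and scalar multiples of 2-forms
  are taken pointwise, using the ring structure on functions.
\<close>

abbreviation E :: "'n::finite \<Rightarrow> real ^ 'n" where
  "E i \<equiv> axis i 1"

type_synonym 'n form2 = "(real, 'n) vec \<Rightarrow> (real, 'n) vec \<Rightarrow> real"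

definition wedge_form :: "'n::finite \<Rightarrow> 'n \<Rightarrow> 'n form2" ("\<alpha>") where
  "\<alpha> i j = (\<lambda>x y. x $ i * y $ j - y $ i * x $ j)"

text \<open>
  The bracket for which the i-th coordinate form has differential the i-th entry of the list,
  where the differential of a 1-form \<open>\<beta>\<close> is \<open>d\<beta>(x, y) = - \<beta>([x, y])\<close>.
\<close>

definition bracket_of_diffs ::
    "'n form2 list \<Rightarrow> (real, 'n::{finite,one,plus}) vec \<Rightarrow> (real, 'n) vec \<Rightarrow> (real, 'n) vec" where
  "bracket_of_diffs ds x y = vector (map (\<lambda>d. - d x y) ds)"

definition mk_bilag ::
    "'n form2 list \<Rightarrow> 'n form2 \<Rightarrow> (real, 'n::{finite,one,plus}) vec set \<Rightarrow> (real, 'n) vec set \<Rightarrow>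
     (real, 'n) vec bilag" where
  "mk_bilag ds \<omega> BF BG =
     \<lparr>bracket = bracket_of_diffs ds, omega = \<omega>, subF = span BF, subG = span BG\<rparr>"

datatype index2 = A2
datatype index4 = A4 | L3_A1
datatype index6 =
    A6 | L3_A3 | L5_2_A1 | L3_L3 | L6_1 | L6_2 | L5_3_A1 | L6_4 | L6_5 | L6_6 | L6_9
  | L6_10 | L6_11 | L6_12 | L5_4_A1 | L6_16

primrec example2 :: "index2 \<Rightarrow> (real ^ 2) bilag" where
  "example2 A2 = mk_bilag [0, 0] (\<alpha> 1 2) {E 1} {E 2}"

primrec example4 :: "index4 \<Rightarrow> (real ^ 4) bilag" where
  "example4 A4 = mk_bilag [0, 0, 0, 0] (\<alpha> 1 2 + \<alpha> 3 4) {E 1, E 3} {E 2, E 4}"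
| "example4 L3_A1 = mk_bilag [0, 0, 0, \<alpha> 1 2] (\<alpha> 1 4 + \<alpha> 2 3) {E 1, E 3} {E 2, E 4}"

primrec example6 :: "index6 \<Rightarrow> (real ^ 6) bilag" where
  "example6 A6 = mk_bilag [0, 0, 0, 0, 0, 0]
     (\<alpha> 1 2 + \<alpha> 3 4 + \<alpha> 5 6)
     {E 1, E 3, E 5} {E 2, E 4, E 6}"
| "example6 L3_A3 = mk_bilag [0, 0, 0, 0, 0, \<alpha> 1 2]
     (\<alpha> 1 6 + \<alpha> 2 3 + \<alpha> 4 5)
     {E 1, E 3, E 4} {E 2, E 5, E 6}"
| "example6 L5_2_A1 = mk_bilag [0, 0, 0, 0, \<alpha> 1 2, \<alpha> 1 3]
     (\<alpha> 1 5 + \<alpha> 2 4 + \<alpha> 3 6)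
     {E 1, E 4, E 6} {E 2, E 3, E 5}"
| "example6 L3_L3 = mk_bilag [0, 0, 0, 0, \<alpha> 1 2, \<alpha> 3 4]
     (\<alpha> 1 5 + \<alpha> 2 4 + \<alpha> 3 6)
     {E 1, E 4, E 6} {E 2, E 3, E 5}"
| "example6 L6_1 = mk_bilag [0, 0, 0, 0, \<alpha> 1 2, \<alpha> 1 3 + \<alpha> 2 4]
     (\<alpha> 1 6 + \<alpha> 2 3 - \<alpha> 4 5)
     {E 1, E 2, E 5} {E 3, E 4, E 6}"
| "example6 L6_2 = mk_bilag [0, 0, 0, 0, \<alpha> 1 3 - \<alpha> 2 4, \<alpha> 1 4 + \<alpha> 2 3]
     (\<alpha> 1 6 + \<alpha> 2 5 + \<alpha> 3 4)
     {E 1, E 3, E 5} {E 1 + E 2, E 4, E 5 - E 6}"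
| "example6 L5_3_A1 = mk_bilag [0, 0, 0, 0, \<alpha> 1 2, \<alpha> 1 5 + \<alpha> 2 3]
     (\<alpha> 1 6 + \<alpha> 2 4 - \<alpha> 3 5)
     {E 1, E 3, E 4} {E 2, E 5, E 6}"
| "example6 L6_4 = mk_bilag [0, 0, 0, \<alpha> 1 2, \<alpha> 1 3, \<alpha> 2 3]
     (\<alpha> 1 6 + 2 * \<alpha> 2 5 + \<alpha> 3 4)
     {E 1, E 2, E 4} {E 3, E 5, E 6}"
| "example6 L6_5 = mk_bilag [0, 0, 0, \<alpha> 1 2, \<alpha> 1 3, \<alpha> 1 4]
     (\<alpha> 1 6 + \<alpha> 2 5 + \<alpha> 3 4)
     {E 1, E 3, E 5} {E 2, E 4, E 6}"
| "example6 L6_6 = mk_bilag [0, 0, 0, \<alpha> 1 2, \<alpha> 1 3, \<alpha> 2 4]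
     (\<alpha> 1 5 + \<alpha> 2 5 - \<alpha> 2 6 + \<alpha> 3 4)
     {E 1 - E 2, E 3, E 5} {E 1 + E 5, E 4, E 6}"
| "example6 L6_9 = mk_bilag [0, 0, 0, \<alpha> 1 2, \<alpha> 1 3, \<alpha> 1 4 + \<alpha> 2 3]
     (\<alpha> 1 6 + 2 * \<alpha> 2 5 + \<alpha> 3 4)
     {E 1, E 3, E 5} {E 2, E 4, E 6}"
| "example6 L6_10 = mk_bilag [0, 0, 0, \<alpha> 1 2, \<alpha> 1 4, \<alpha> 2 3 + \<alpha> 2 4]
     (\<alpha> 1 6 + \<alpha> 2 5 - \<alpha> 3 4)
     {E 1, E 4, E 5} {E 2 - E 4, E 3 + E 5, E 6}"
| "example6 L6_11 = mk_bilag [0, 0, 0, \<alpha> 1 2, \<alpha> 1 4, \<alpha> 1 3 + \<alpha> 2 4]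
     (\<alpha> 1 6 + \<alpha> 2 5 - \<alpha> 2 6 - \<alpha> 3 4)
     {E 1, E 4, E 5} {E 1 + E 2 - E 4, E 3 + E 5, E 6}"
| "example6 L6_12 = mk_bilag [0, 0, 0, \<alpha> 1 2, \<alpha> 1 4 + \<alpha> 2 3, \<alpha> 1 3 - \<alpha> 2 4]
     (- \<alpha> 1 5 + 6 * \<alpha> 2 6 + 7 * \<alpha> 3 4)
     {E 2, E 3, E 5} {E 2 - 2 *\<^sub>R E 1, E 3 - E 4, - 3 *\<^sub>R E 5 + E 6}"
| "example6 L5_4_A1 = mk_bilag [0, 0, 0, \<alpha> 1 2, \<alpha> 1 4, \<alpha> 1 5]
     (\<alpha> 1 3 + \<alpha> 2 6 - \<alpha> 4 5)
     {E 1, E 5, E 6} {E 2, E 3, E 4}"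
| "example6 L6_16 = mk_bilag [0, 0, \<alpha> 1 2, \<alpha> 1 3, \<alpha> 2 3, \<alpha> 1 4]
     (\<alpha> 1 5 + \<alpha> 2 4 + \<alpha> 2 6 - \<alpha> 3 4)
     {E 1, E 4, E 6} {E 2, E 3, E 5}"

end

theory Submission
  imports Defs
begin

text \<open>
  The canonical connection of a bi-Lagrangian structure is defined through the definite descriptions
  \<^const>\<open>compF\<close>, \<^const>\<open>compG\<close> and \<^const>\<open>connD\<close>, which do not lend themselves to calculation.
  It is, however, the only torsion-free connection that preserves both Lagrangian subspaces and makes the symplectic form parallel. So for each example it suffices to write down
  the Christoffel symbols of a candidate (\<open>connection2\<close>, \<open>connection4\<close>, \<open>connection6\<close>) and to check these
  properties, which are polynomial identities in coordinates.

  The same candidate certifies most of the bi-Lagrangian structure itself. If \<open>\<nabla>\<close> is torsion-free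
  and preserves F and G, then \<open>[x, y] = \<nabla>\<^sub>x y - \<nabla>\<^sub>y x\<close> shows that both are subalgebras; if moreover
  \<open>\<omega>\<close> is parallel, then it is closed. If F and G are isotropic and only the zero vector is
  \<open>\<omega>\<close>-orthogonal to both, then \<open>\<omega>\<close> is non-degenerate, F and G are Lagrangian, and they are
  complementary. Membership in F and G need never be tested directly: a vector lies in a Lagrangian
  subspace exactly when \<open>\<omega>\<close> pairs it to zero with the generators. These facts form the locale
  \<open>bilag_connection\<close>, and \<open>bilag_connection_mk_bilagI\<close> reduces its assumptions to generators.

  With the connection known explicitly, flatness is an identity in three vectors, and non-flatness
  is witnessed by a single value of the curvature on basis vectors. In every example all composites
  of four operators of the forms \<open>\<nabla>\<^sub>X\<close> and \<open>ad\<^sub>X\<close> vanish, so that these operators are strictly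
  triangular with respect to a common flag. This is why the Lie algebras are nilpotent, and also why
  the Ricci curvature vanishes: by torsion-freeness \<open>R(Z, X)Y\<close> is obtained from \<open>Z\<close> by linear
  combinations of products of such operators, and those have trace zero. The proof evaluates the
  trace directly.
\<close>

section \<open>Bilinear forms\<close>

lemma bilinear_zero_on_span:
  assumes "bilinear h" and "\<And>a b. a \<in> A \<Longrightarrow> b \<in> B \<Longrightarrow> h a b = (0::'b::real_vector)"
    and "x \<in> span A" and "y \<in> span B"
  shows "h x y = 0"
  by (rule bilinear_eq[of h "\<lambda>_ _. 0" "span A" A "span B" B])
     (use assms in \<open>auto simp: bilinear_def linear_zero\<close>)

text \<open>
  The form \<open>\<omega>\<close> turns into an endomorphism \<open>J\<close> through the inner product, and an injective
  endomorphism of a finite-dimensional space is surjective.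
\<close>

lemma representing_vector:
  fixes \<omega> :: "'a::euclidean_space \<Rightarrow> 'a \<Rightarrow> real"
  assumes "bilinear \<omega>" and nondeg: "\<And>x. (\<And>y. \<omega> x y = 0) \<Longrightarrow> x = 0" and "linear f"
  obtains v where "\<And>y. \<omega> v y = f y"
proof -
  define J where "J x = (\<Sum>i\<in>Basis. \<omega> x i *\<^sub>R i)" for x
  have J: "J x \<bullet> y = \<omega> x y" for x y
  proof -
    have "J x \<bullet> y = (\<Sum>i\<in>Basis. \<omega> x ((y \<bullet> i) *\<^sub>R i))"
      unfolding J_def inner_sum_left
      by (simp add: bilinear_rmul[OF assms(1)] inner_commute[of y] mult.commute)
    also have "\<dots> = \<omega> x (\<Sum>i\<in>Basis. (y \<bullet> i) *\<^sub>R i)"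
      using assms(1) by (simp add: bilinear_def linear_sum)
    finally show ?thesis by (simp add: euclidean_representation)
  qed
  have lin: "linear J"
    by (rule linearI)
       (simp_all add: J_def bilinear_ladd[OF assms(1)] bilinear_lmul[OF assms(1)]
         scaleR_left_distrib sum.distrib scaleR_sum_right)
  have "inj J"
    unfolding linear_injective_0[OF lin] using nondeg J by (metis inner_zero_left)
  then have "surj J"
    using linear_injective_imp_surjective[OF lin] by simp
  then obtain v where v: "J v = (\<Sum>i\<in>Basis. f i *\<^sub>R i)" by (metis surjD)
  have "\<omega> v y = f y" for y
  proof -
    have "\<omega> v y = (\<Sum>i\<in>Basis. f i * (i \<bullet> y))"
      by (simp flip: J add: v inner_sum_left)
    also have "\<dots> = f (\<Sum>i\<in>Basis. (y \<bullet> i) *\<^sub>R i)"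
      using assms(3) by (simp add: linear_sum linear_cmul inner_commute mult.commute)
    finally show ?thesis by (simp add: euclidean_representation)
  qed
  then show thesis by (rule that)
qed

section \<open>Uniqueness of the canonical connection\<close>

text \<open>
  By \<open>isotropic_F\<close>, \<open>isotropic_G\<close> and \<open>total\<close> each of F and G is its own orthogonal complement, so
  \<open>conn_F\<close> and \<open>conn_G\<close> say that \<^term>\<open>conn\<close> preserves F and G, in a form that can be
  checked on generators.
\<close>

locale bilag_connection =
  fixes S :: "'a::euclidean_space bilag" and conn :: "'a \<Rightarrow> 'a \<Rightarrow> 'a"
  assumes lie: "lie_algebra (bracket S)"
    and omega_bilinear: "bilinear (omega S)"
    and omega_self: "omega S x x = 0"
    and subspace_F: "subspace (subF S)" and subspace_G: "subspace (subG S)"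
    and isotropic_F: "\<lbrakk>y \<in> subF S; z \<in> subF S\<rbrakk> \<Longrightarrow> omega S y z = 0"
    and isotropic_G: "\<lbrakk>y \<in> subG S; z \<in> subG S\<rbrakk> \<Longrightarrow> omega S y z = 0"
    and total: "(\<And>y. y \<in> subF S \<union> subG S \<Longrightarrow> omega S x y = 0) \<Longrightarrow> x = 0"
    and conn_linear: "linear (conn x)"
    and torsion_free: "conn x y - conn y x = bracket S x y"
    and parallel: "omega S (conn x y) z + omega S y (conn x z) = 0"
    and conn_F: "\<lbrakk>y \<in> subF S; z \<in> subF S\<rbrakk> \<Longrightarrow> omega S (conn x y) z = 0"
    and conn_G: "\<lbrakk>y \<in> subG S; z \<in> subG S\<rbrakk> \<Longrightarrow> omega S (conn x y) z = 0"
begin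

lemmas omega_simps = bilinear_ladd[OF omega_bilinear] bilinear_radd[OF omega_bilinear]
  bilinear_lsub[OF omega_bilinear] bilinear_rsub[OF omega_bilinear]
  bilinear_lneg[OF omega_bilinear] bilinear_rneg[OF omega_bilinear]

lemma omega_swap: "omega S x y = - omega S y x"
  using omega_self[of "x + y"] omega_self[of x] omega_self[of y] by (simp add: omega_simps)

lemma omega_nondegenerate: "(\<And>y. omega S x y = 0) \<Longrightarrow> x = 0"
  using total by blast

text \<open>
  If F and G did not span, some nonzero linear functional would kill both; by non-degeneracy it is
  of the form \<open>\<omega>(v, -)\<close>, and then \<open>v\<close> contradicts \<open>total\<close>.
\<close>

lemma decomposition: obtains f g where "f \<in> subF S" "g \<in> subG S" "x = f + g"
proof -
  have "span (subF S \<union> subG S) = UNIV"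
  proof (rule ccontr)
    assume "span (subF S \<union> subG S) \<noteq> UNIV"
    then obtain a where a: "a \<noteq> 0" "span (subF S \<union> subG S) \<subseteq> {x. a \<bullet> x = 0}"
      using span_not_univ_subset_hyperplane by blast
    obtain v where v: "\<And>y. omega S v y = a \<bullet> y"
      using representing_vector[OF omega_bilinear omega_nondegenerate bounded_linear.linear[OF bounded_linear_inner_right]]
      by metis
    have "v = 0"
    proof (rule total)
      fix y assume "y \<in> subF S \<union> subG S"
      then have "y \<in> span (subF S \<union> subG S)" by (rule span_base)
      with a(2) v show "omega S v y = 0" by auto
    qed
    then have "a \<bullet> a = 0" using v[of a] bilinear_lzero[OF omega_bilinear] by simp
    with a(1) show False by simp
  qed
  then have "x \<in> span (subF S \<union> subG S)" by simp
  then show thesis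
    using that unfolding span_Un span_eq_iff[THEN iffD2, OF subspace_F] span_eq_iff[THEN iffD2, OF subspace_G]
    by auto
qed

text \<open>
  An isotropic summand with isotropic complement is Lagrangian: if \<open>f + g\<close> is orthogonal to F then
  so is \<open>g\<close>, which is orthogonal to G anyway, hence zero.
\<close>

lemma mem_F_iff: "x \<in> subF S \<longleftrightarrow> (\<forall>y\<in>subF S. omega S x y = 0)"
proof
  assume perp: "\<forall>y\<in>subF S. omega S x y = 0"
  obtain f g where fg: "f \<in> subF S" "g \<in> subG S" "x = f + g" by (rule decomposition)
  have "g = 0"
  proof (rule total)
    fix y assume "y \<in> subF S \<union> subG S"
    then show "omega S g y = 0"
      using perp fg isotropic_F isotropic_G by (auto simp: omega_simps)
  qed
  with fg show "x \<in> subF S" by simp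
qed (use isotropic_F in auto)

lemma mem_G_iff: "x \<in> subG S \<longleftrightarrow> (\<forall>y\<in>subG S. omega S x y = 0)"
proof
  assume perp: "\<forall>y\<in>subG S. omega S x y = 0"
  obtain f g where fg: "f \<in> subF S" "g \<in> subG S" "x = f + g" by (rule decomposition)
  have "f = 0"
  proof (rule total)
    fix y assume "y \<in> subF S \<union> subG S"
    then show "omega S f y = 0"
      using perp fg isotropic_F isotropic_G by (auto simp: omega_simps)
  qed
  with fg show "x \<in> subG S" by simp
qed (use isotropic_G in auto)

lemma F_Int_G: "subF S \<inter> subG S = {0}"
  using total isotropic_F isotropic_G subspace_0[OF subspace_F] subspace_0[OF subspace_G] by blast

lemma conn_mem_F: "y \<in> subF S \<Longrightarrow> conn x y \<in> subF S"
  using conn_F by (subst mem_F_iff) blast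

lemma conn_mem_G: "y \<in> subG S \<Longrightarrow> conn x y \<in> subG S"
  using conn_G by (subst mem_G_iff) blast

text \<open>
  A torsion-free connection writes the exterior derivative of a form as the alternating sum of its
  covariant derivatives, so a parallel form is closed.
\<close>

lemma omega_closed: "ext_deriv2 (bracket S) (omega S) x y z = 0"
  using parallel[of x y z] parallel[of y x z] parallel[of z x y]
    omega_swap[of x "conn y z"] omega_swap[of y "conn x z"] omega_swap[of x "conn z y"]
  by (simp add: ext_deriv2_def omega_simps flip: torsion_free)

text \<open>
  The subspaces are subalgebras because \<open>[x, y] = \<nabla>\<^sub>x y - \<nabla>\<^sub>y x\<close> and the connection preserves them.
\<close>

theorem bi_lagrangian: "bi_lagrangian S"
proof -
  have sub: "lie_subalgebra (bracket S) (subF S)" "lie_subalgebra (bracket S) (subG S)"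
    unfolding lie_subalgebra_def
    by (simp_all add: subspace_F subspace_G conn_mem_F conn_mem_G subspace_diff flip: torsion_free)
  have lag: "lagrangian (omega S) (subF S)" "lagrangian (omega S) (subG S)"
    unfolding lagrangian_def using subspace_F subspace_G mem_F_iff mem_G_iff by blast+
  have sympl: "symplectic_form (bracket S) (omega S)"
    unfolding symplectic_form_def
    using omega_bilinear omega_self omega_closed omega_nondegenerate by blast
  have "{x + y | x y. x \<in> subF S \<and> y \<in> subG S} = UNIV"
    by (intro set_eqI iffI UNIV_I) (use decomposition in blast)
  with lie sub lag sympl F_Int_G show ?thesis unfolding bi_lagrangian_def by blast
qed

lemma decomposition_unique:
  assumes "f \<in> subF S" "g \<in> subG S" "f' \<in> subF S" "g' \<in> subG S" "f + g = f' + g'"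
  shows "f = f'"
proof -
  have "f - f' = g' - g" using assms(5) by (simp add: algebra_simps)
  with assms subspace_diff[OF subspace_F] subspace_diff[OF subspace_G]
  have "f - f' \<in> subF S \<inter> subG S" by (metis IntI)
  then show ?thesis by (simp add: F_Int_G)
qed

lemma compF_eq:
  assumes "f \<in> subF S" "x - f \<in> subG S"
  shows "compF S x = f"
  unfolding compF_def
proof (rule the_equality)
  fix u assume "u \<in> subF S \<and> x - u \<in> subG S"
  then show "u = f"
    using assms decomposition_unique[of u "x - u" f "x - f"] by simp
qed (use assms in simp)

lemma compG_eq:
  assumes "g \<in> subG S" "x - g \<in> subF S"
  shows "compG S x = g"
  unfolding compG_def
proof (rule the_equality)
  fix v assume "v \<in> subG S \<and> x - v \<in> subF S"
  then have "x - v = x - g"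
    using assms decomposition_unique[of "x - v" v "x - g" g] by simp
  then show "v = g" by simp
qed (use assms in simp)

text \<open>
  This justifies the definite description behind \<^const>\<open>connD\<close>.
\<close>

lemma omega_connD: "omega S (connD S x y) z = - omega S y (bracket S x z)"
proof -
  have "linear (\<lambda>z. - omega S y (bracket S x z))"
    using lie omega_bilinear unfolding lie_algebra_def bilinear_def
    by (intro linear_compose_neg linear_compose[of "bracket S x" "omega S y", unfolded o_def]) auto
  then obtain v where v: "\<And>z. omega S v z = - omega S y (bracket S x z)"
    using representing_vector[OF omega_bilinear omega_nondegenerate] by metis
  have "connD S x y = v"
    unfolding connD_def
  proof (rule the_equality)
    fix w assume w: "\<forall>z. omega S w z = - omega S y (bracket S x z)"
    have "w - v = 0"
      by (rule omega_nondegenerate) (use v w in \<open>simp add: omega_simps\<close>)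
    then show "w = v" by simp
  qed (use v in simp)
  with v show ?thesis by simp
qed

text \<open>
  Since G is Lagrangian, the F-component of a vector is determined by its pairing with G. For
  \<open>z\<close> in G torsion-freeness gives \<open>\<omega>(D(x, y), z) = \<omega>(y, \<nabla>\<^sub>z x) - \<omega>(y, \<nabla>\<^sub>x z)\<close>; the first term pairs
  two vectors of F, and the second is \<open>\<omega>(\<nabla>\<^sub>x y, z)\<close> as \<open>\<omega>\<close> is parallel.
\<close>

lemma compF_connD:
  assumes "x \<in> subF S" "y \<in> subF S"
  shows "compF S (connD S x y) = conn x y"
proof (rule compF_eq)
  show "connD S x y - conn x y \<in> subG S"
    unfolding mem_G_iff
  proof
    fix z assume z: "z \<in> subG S"
    have "omega S (connD S x y) z = omega S y (conn z x) - omega S y (conn x z)"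
      by (simp add: omega_connD omega_simps flip: torsion_free)
    moreover have "omega S y (conn z x) = 0"
      using assms conn_mem_F isotropic_F by blast
    ultimately show "omega S (connD S x y - conn x y) z = 0"
      using parallel[of x y z] by (simp add: omega_simps)
  qed
qed (use assms conn_mem_F in blast)

lemma compG_connD:
  assumes "x \<in> subG S" "y \<in> subG S"
  shows "compG S (connD S x y) = conn x y"
proof (rule compG_eq)
  show "connD S x y - conn x y \<in> subF S"
    unfolding mem_F_iff
  proof
    fix z assume z: "z \<in> subF S"
    have "omega S (connD S x y) z = omega S y (conn z x) - omega S y (conn x z)"
      by (simp add: omega_connD omega_simps flip: torsion_free)
    moreover have "omega S y (conn z x) = 0"
      using assms conn_mem_G isotropic_G by blast
    ultimately show "omega S (connD S x y - conn x y) z = 0"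
      using parallel[of x y z] by (simp add: omega_simps)
  qed
qed (use assms conn_mem_G in blast)

text \<open>
  Here \<open>[x, y] = \<nabla>\<^sub>x y - \<nabla>\<^sub>y x\<close> is already the decomposition along F and G.
\<close>

lemma compF_bracket:
  assumes "x \<in> subG S" "y \<in> subF S"
  shows "compF S (bracket S x y) = conn x y"
  by (rule compF_eq)
     (use assms conn_mem_F conn_mem_G subspace_neg[OF subspace_G] in \<open>auto simp flip: torsion_free\<close>)

lemma compG_bracket:
  assumes "x \<in> subF S" "y \<in> subG S"
  shows "compG S (bracket S x y) = conn x y"
  by (rule compG_eq)
     (use assms conn_mem_F conn_mem_G subspace_neg[OF subspace_F] in \<open>auto simp flip: torsion_free\<close>)

lemma conn_add_left: "conn (x + x') y = conn x y + conn x' y"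
proof -
  have "bracket S (x + x') y = bracket S x y + bracket S x' y"
    using lie by (auto simp: lie_algebra_def bilinear_ladd)
  then show ?thesis
    using torsion_free[of "x + x'" y] torsion_free[of x y] torsion_free[of x' y]
      linear_add[OF conn_linear, of y x x'] by (simp add: algebra_simps)
qed

text \<open>
  Uniqueness of the canonical connection: on each of the four blocks given by the types of the two
  arguments the defining formula returns \<^term>\<open>conn\<close>, and both sides are additive in each argument.
\<close>

theorem canonical_connection: "canonical_connection S = conn"
proof (intro ext)
  fix X Y
  obtain XF XG where X: "XF \<in> subF S" "XG \<in> subG S" "X = XF + XG" by (rule decomposition)
  obtain YF YG where Y: "YF \<in> subF S" "YG \<in> subG S" "Y = YF + YG" by (rule decomposition)
  have "compF S X = XF" "compG S X = XG" "compF S Y = YF" "compG S Y = YG"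
    using X Y by (auto intro!: compF_eq compG_eq)
  then have "canonical_connection S X Y = conn XF YF + conn XG YF + (conn XG YG + conn XF YG)"
    using X Y by (simp add: canonical_connection_def compF_connD compG_connD compF_bracket compG_bracket)
  then show "canonical_connection S X Y = conn X Y"
    by (simp add: X Y conn_add_left linear_add[OF conn_linear])
qed

corollary curvature_eq:
  "curvature S X Y Z = conn X (conn Y Z) - conn Y (conn X Z) - conn (bracket S X Y) Z"
  by (simp add: curvature_def canonical_connection)

end

section \<open>Nilpotency\<close>

lemma foldr_bracket_spans:
  assumes "\<And>x. linear (br x)"
  shows "lower_central_series br k \<subseteq> span {foldr br xs y | xs y. length xs = k}"
proof (induction k)
  case 0
  have "foldr br [] y \<in> span {foldr br xs y | xs y. length xs = 0}" for y
    by (intro span_base) blast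
  then show ?case by auto
next
  case (Suc k)
  let ?A = "\<lambda>k. {foldr br xs y | xs y. length xs = k}"
  have step: "br x y \<in> span (?A (Suc k))" if "y \<in> lower_central_series br k" for x y
  proof -
    have "br x v \<in> ?A (Suc k)" if v: "v \<in> ?A k" for v
    proof -
      obtain xs y where "v = foldr br xs y" "length xs = k" using v by blast
      then have "br x v = foldr br (x # xs) y" "length (x # xs) = Suc k" by simp_all
      then show ?thesis by blast
    qed
    then have "br x ` ?A k \<subseteq> ?A (Suc k)" by (rule image_subsetI)
    then have "span (br x ` ?A k) \<subseteq> span (?A (Suc k))" by (rule span_mono)
    then have "br x ` span (?A k) \<subseteq> span (?A (Suc k))"
      by (simp only: linear_span_image[OF assms])
    moreover have "y \<in> span (?A k)" using that Suc.IH by (rule subsetD[rotated])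
    ultimately show ?thesis by (rule subsetD[OF _ imageI])
  qed
  show ?case
    unfolding lower_central_series.simps
  proof (intro span_minimal subspace_span subsetI)
    fix v assume "v \<in> {br x y | x y. y \<in> lower_central_series br k}"
    then obtain x y where "v = br x y" "y \<in> lower_central_series br k" by auto
    then show "v \<in> span (?A (Suc k))" by (simp only: step)
  qed
qed

lemma nilpotentI:
  assumes "lie_algebra br" and "\<And>xs y. length xs = k \<Longrightarrow> foldr br xs y = 0"
  shows "nilpotent_lie_algebra br"
proof -
  have "lower_central_series br k \<subseteq> {0}"
  proof -
    have "linear (br x)" for x
      using assms(1) by (simp add: lie_algebra_def bilinear_def)
    then have "lower_central_series br k \<subseteq> span {foldr br xs y | xs y. length xs = k}"
      by (rule foldr_bracket_spans)
    also have "\<dots> \<subseteq> span {0}"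
      using assms(2) by (intro span_mono) auto
    finally show ?thesis by simp
  qed
  moreover have "0 \<in> lower_central_series br k"
    by (cases k) (auto simp: span_zero)
  ultimately show ?thesis
    using assms(1) unfolding nilpotent_lie_algebra_def by blast
qed

section \<open>Structures given by 2-forms\<close>

definition two_form :: "('a::real_vector \<Rightarrow> 'a \<Rightarrow> real) \<Rightarrow> bool" where
  "two_form \<beta> \<longleftrightarrow> bilinear \<beta> \<and> (\<forall>x. \<beta> x x = 0)"

lemma two_form_0 [simp]: "two_form 0"
  by (simp add: two_form_def bilinear_def linear_zero zero_fun_def)

lemma two_form_wedge [simp]: "two_form (\<alpha> i j)"
  unfolding two_form_def bilinear_def wedge_form_def
  by (auto intro!: linearI simp: algebra_simps)

lemma two_form_add [simp]: "two_form \<beta> \<Longrightarrow> two_form \<gamma> \<Longrightarrow> two_form (\<beta> + \<gamma>)"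
  by (auto simp: two_form_def bilinear_def intro: linear_compose_add)

lemma two_form_diff [simp]: "two_form \<beta> \<Longrightarrow> two_form \<gamma> \<Longrightarrow> two_form (\<beta> - \<gamma>)"
  by (auto simp: two_form_def bilinear_def intro: linear_compose_sub)

lemma two_form_minus [simp]: "two_form \<beta> \<Longrightarrow> two_form (- \<beta>)"
  by (auto simp: two_form_def bilinear_def intro: linear_compose_neg)

lemma two_form_numeral_mult [simp]: "two_form \<beta> \<Longrightarrow> two_form (numeral n * \<beta>)"
  using linear_compose_scale_right[where c = "numeral n :: real"]
  by (fastforce simp: two_form_def bilinear_def)

text \<open>
  Each coordinate of the bracket is, up to sign, one fixed entry of the list, or zero, whatever the length of the
  list compared with the dimension (\<^const>\<open>vector\<close> truncates, and pads with zeros). Properties of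
  2-forms therefore pass to the bracket without a bound on the length.
\<close>

lemma bracket_of_diffs_nth:
  obtains d where "d = 0 \<or> d \<in> set ds" and "\<And>x y. bracket_of_diffs ds x y $ i = - d x y"
proof -
  have "\<exists>d. (d = 0 \<or> d \<in> set ds) \<and>
      (\<forall>x y. foldr (\<lambda>x f n. fun_upd (f (n + 1)) n x) (map (\<lambda>d. - d x y) ds) (\<lambda>n x. 0) k i = - d x y)"
    for k
  proof (induction ds arbitrary: k)
    case Nil
    then show ?case by (intro exI[of _ 0]) simp
  next
    case (Cons d ds)
    show ?case
    proof (cases "i = k")
      case True
      then show ?thesis by (intro exI[of _ d]) simp
    next
      case False
      with Cons.IH[of "k + 1"] show ?thesis by auto
    qed
  qed
  then show thesis
    using that by (fastforce simp: bracket_of_diffs_def vector_def)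
qed

lemma bilinear_bracket_of_diffs:
  assumes "\<forall>d\<in>set ds. two_form d"
  shows "bilinear (bracket_of_diffs ds)"
proof -
  have "bracket_of_diffs ds (x + x') y = bracket_of_diffs ds x y + bracket_of_diffs ds x' y \<and>
      bracket_of_diffs ds (c *\<^sub>R x) y = c *\<^sub>R bracket_of_diffs ds x y \<and>
      bracket_of_diffs ds x (y + y') = bracket_of_diffs ds x y + bracket_of_diffs ds x y' \<and>
      bracket_of_diffs ds x (c *\<^sub>R y) = c *\<^sub>R bracket_of_diffs ds x y" for x x' y y' c
    unfolding vec_eq_iff all_conj_distrib[symmetric]
  proof
    fix i
    obtain d where d: "d = 0 \<or> d \<in> set ds" and comp: "\<And>x y. bracket_of_diffs ds x y $ i = - d x y"
      using bracket_of_diffs_nth by blast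
    from d have "bilinear d"
      using assms two_form_0 by (auto simp: two_form_def)
    then show "bracket_of_diffs ds (x + x') y $ i = (bracket_of_diffs ds x y + bracket_of_diffs ds x' y) $ i \<and>
      bracket_of_diffs ds (c *\<^sub>R x) y $ i = (c *\<^sub>R bracket_of_diffs ds x y) $ i \<and>
      bracket_of_diffs ds x (y + y') $ i = (bracket_of_diffs ds x y + bracket_of_diffs ds x y') $ i \<and>
      bracket_of_diffs ds x (c *\<^sub>R y) $ i = (c *\<^sub>R bracket_of_diffs ds x y) $ i"
      by (simp add: comp bilinear_ladd bilinear_lmul bilinear_radd bilinear_rmul)
  qed
  then show ?thesis
    unfolding bilinear_def by (auto intro!: linearI)
qed

lemma bracket_of_diffs_self:
  assumes "\<forall>d\<in>set ds. two_form d"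
  shows "bracket_of_diffs ds x x = 0"
  unfolding vec_eq_iff
proof
  fix i
  obtain d where "d = 0 \<or> d \<in> set ds" "bracket_of_diffs ds x x $ i = - d x x"
    using bracket_of_diffs_nth by metis
  with assms show "bracket_of_diffs ds x x $ i = 0 $ i" by (auto simp: two_form_def)
qed

text \<open>
  Apart from \<open>forms\<close> and \<open>conn_linear\<close>, every premise is a polynomial identity in the coordinates of at
  most three vectors, or a system of linear equations (\<open>total\<close>), once the generators are explicit.
\<close>

lemma bilag_connection_mk_bilagI:
  assumes forms: "\<forall>d\<in>set ds. two_form d" "two_form \<omega>"
    and jacobi: "\<forall>x y z. bracket_of_diffs ds x (bracket_of_diffs ds y z) +
      bracket_of_diffs ds y (bracket_of_diffs ds z x) +
      bracket_of_diffs ds z (bracket_of_diffs ds x y) = 0"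
    and isotropic: "\<forall>b\<in>BF. \<forall>c\<in>BF. \<omega> b c = 0" "\<forall>b\<in>BG. \<forall>c\<in>BG. \<omega> b c = 0"
    and total: "\<forall>x. (\<forall>b\<in>BF \<union> BG. \<omega> x b = 0) \<longrightarrow> x = 0"
    and conn_linear: "\<forall>x. linear (conn x)"
    and torsion_free: "\<forall>x y. conn x y - conn y x = bracket_of_diffs ds x y"
    and parallel: "\<forall>x y z. \<omega> (conn x y) z + \<omega> y (conn x z) = 0"
    and preserved: "\<forall>x. \<forall>b\<in>BF. \<forall>c\<in>BF. \<omega> (conn x b) c = 0"
      "\<forall>x. \<forall>b\<in>BG. \<forall>c\<in>BG. \<omega> (conn x b) c = 0"
  shows "bilag_connection (mk_bilag ds \<omega> BF BG) conn"
proof -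
  have \<omega>: "bilinear \<omega>" using forms by (simp add: two_form_def)
  have conn: "bilinear (\<lambda>y. \<omega> (conn x y))" for x
    using \<omega> conn_linear unfolding bilinear_def by (auto intro: linear_compose[unfolded o_def])
  have "lie_algebra (bracket_of_diffs ds)"
    unfolding lie_algebra_def
    using bilinear_bracket_of_diffs[OF forms(1)] bracket_of_diffs_self[OF forms(1)] jacobi by blast
  moreover have "x = 0" if "\<And>y. y \<in> span BF \<union> span BG \<Longrightarrow> \<omega> x y = 0" for x
    using total that by (meson Un_iff span_base)
  moreover have "\<omega> y z = 0" if "y \<in> span B" "z \<in> span B" "B = BF \<or> B = BG" for y z B
    by (rule bilinear_zero_on_span[OF \<omega> _ that(1,2)]) (use isotropic that(3) in blast)
  moreover have "\<omega> (conn x y) z = 0" if "y \<in> span B" "z \<in> span B" "B = BF \<or> B = BG" for x y z B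
    by (rule bilinear_zero_on_span[OF conn _ that(1,2)]) (use preserved that(3) in blast)
  ultimately show ?thesis
    using \<omega> forms conn_linear torsion_free parallel
    by unfold_locales
       (auto simp: mk_bilag_def two_form_def linear_add[OF conn_linear[rule_format]]
         linear_cmul[OF conn_linear[rule_format]])
qed

section \<open>Coordinates\<close>

lemma exhaust_6:
  fixes x :: 6
  shows "x = 1 \<or> x = 2 \<or> x = 3 \<or> x = 4 \<or> x = 5 \<or> x = 6"
proof (induct x)
  case (of_int z)
  then have "z = 0 \<or> z = 1 \<or> z = 2 \<or> z = 3 \<or> z = 4 \<or> z = 5" by fastforce
  then show ?case by auto
qed

lemma forall_6: "(\<forall>i::6. P i) \<longleftrightarrow> P 1 \<and> P 2 \<and> P 3 \<and> P 4 \<and> P 5 \<and> P 6"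
  by (metis exhaust_6)

lemma UNIV_6: "UNIV = {1, 2, 3, 4, 5, 6::6}"
  using exhaust_6 by auto

lemma sum_6: "sum f (UNIV::6 set) = f 1 + f 2 + f 3 + f 4 + f 5 + f 6"
  unfolding UNIV_6 by (simp add: ac_simps)

lemma vector_4:
  "(vector [a, b, c, d] :: 'a::zero ^ 4) $ 1 = a" "(vector [a, b, c, d] :: 'a ^ 4) $ 2 = b"
  "(vector [a, b, c, d] :: 'a ^ 4) $ 3 = c" "(vector [a, b, c, d] :: 'a ^ 4) $ 4 = d"
  unfolding vector_def by simp_all

lemma vector_6:
  "(vector [a, b, c, d, e, f] :: 'a::zero ^ 6) $ 1 = a"
  "(vector [a, b, c, d, e, f] :: 'a ^ 6) $ 2 = b"
  "(vector [a, b, c, d, e, f] :: 'a ^ 6) $ 3 = c"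
  "(vector [a, b, c, d, e, f] :: 'a ^ 6) $ 4 = d"
  "(vector [a, b, c, d, e, f] :: 'a ^ 6) $ 5 = e"
  "(vector [a, b, c, d, e, f] :: 'a ^ 6) $ 6 = f"
  unfolding vector_def by simp_all

lemma wedge_form_apply: "\<alpha> i j x y = x $ i * y $ j - y $ i * x $ j"
  by (simp add: wedge_form_def)

lemmas coordinates = vec_eq_iff forall_2 forall_4 forall_6 vector_4 vector_6
  bracket_of_diffs_def wedge_form_apply axis_def

section \<open>Verification of the examples\<close>

text \<open>
  The Christoffel symbols come from evaluating the defining formula on basis vectors:
  the coefficient of \<open>x $ i * y $ j\<close> in the k-th entry is the k-th coordinate of the derivative of
  \<open>E j\<close> in the direction \<open>E i\<close>.
\<close>

primrec connection2 :: "index2 \<Rightarrow> real ^ 2 \<Rightarrow> real ^ 2 \<Rightarrow> real ^ 2" where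
  "connection2 A2 x y = vector [0, 0]"

primrec connection4 :: "index4 \<Rightarrow> real ^ 4 \<Rightarrow> real ^ 4 \<Rightarrow> real ^ 4" where
  "connection4 A4 x y = vector [0, 0, 0, 0]"
| "connection4 L3_A1 x y = vector [0, 0, - x $ 1 * y $ 1, - x $ 1 * y $ 2]"

primrec connection6 :: "index6 \<Rightarrow> real ^ 6 \<Rightarrow> real ^ 6 \<Rightarrow> real ^ 6" where
  "connection6 A6 x y = vector [0, 0, 0, 0, 0, 0]"
| "connection6 L3_A3 x y = vector [0, 0, - x $ 1 * y $ 1, 0, 0, - x $ 1 * y $ 2]"
| "connection6 L5_2_A1 x y = vector
     [0, 0, 0, - x $ 1 * y $ 1, - x $ 1 * y $ 2 + x $ 3 * y $ 3, x $ 3 * y $ 1]"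
| "connection6 L3_L3 x y = vector
     [0, x $ 3 * y $ 3, 0, - x $ 1 * y $ 1, - x $ 1 * y $ 2, - x $ 3 * y $ 4]"
| "connection6 L6_1 x y = vector
     [0, x $ 1 * y $ 1, 0, 0, x $ 2 * y $ 1, - x $ 1 * y $ 3 - x $ 2 * y $ 4]"
| "connection6 L6_2 x y = vector
     [0, 0, x $ 1 * y $ 1 - x $ 1 * y $ 2 - x $ 2 * y $ 1 + x $ 2 * y $ 2, - 2 * x $ 2 * y $ 2,
      x $ 1 * y $ 4 - 2 * x $ 2 * y $ 3 - x $ 2 * y $ 4 + x $ 3 * y $ 1 - 2 * x $ 3 * y $ 2
        + x $ 4 * y $ 1 - 2 * x $ 4 * y $ 2,
      - x $ 1 * y $ 4 + x $ 2 * y $ 4 + x $ 3 * y $ 2 + x $ 4 * y $ 2]"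
| "connection6 L5_3_A1 x y = vector
     [0, 0, - x $ 1 * y $ 1, x $ 1 * y $ 3 + x $ 3 * y $ 1, - x $ 1 * y $ 2,
      - x $ 1 * y $ 5 + x $ 3 * y $ 2]"
| "connection6 L6_4 x y = vector
     [0, 0, 0, - 2 * x $ 1 * y $ 2 - x $ 2 * y $ 1, - x $ 1 * y $ 3, - x $ 2 * y $ 3]"
| "connection6 L6_5 x y = vector
     [0, 0, x $ 1 * y $ 1, - x $ 1 * y $ 2, - x $ 1 * y $ 3, - x $ 1 * y $ 4]"
| "connection6 L6_6 x y = vector
     [0, 0, - x $ 2 * y $ 2, - x $ 1 * y $ 1 - x $ 1 * y $ 2, - x $ 1 * y $ 3, - x $ 2 * y $ 4]"
| "connection6 L6_9 x y = vector
     [0, 0, x $ 1 * y $ 1, - x $ 1 * y $ 2, - 1/2 * x $ 1 * y $ 3 + 1/2 * x $ 3 * y $ 1,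
      - x $ 1 * y $ 4 + x $ 3 * y $ 2]"
| "connection6 L6_10 x y = vector
     [0, 0, 0, x $ 2 * y $ 1, x $ 4 * y $ 1, - x $ 2 * y $ 3 + x $ 4 * y $ 2]"
| "connection6 L6_11 x y = vector
     [0, 0, - x $ 2 * y $ 2, x $ 1 * y $ 1 - x $ 1 * y $ 2,
      - 2 * x $ 2 * y $ 2 - x $ 2 * y $ 4 + x $ 4 * y $ 1 - x $ 4 * y $ 2,
      - x $ 1 * y $ 3 + x $ 4 * y $ 2]"
| "connection6 L6_12 x y = vector
     [0, 0,
      - 11/7 * x $ 1 * y $ 1 - 10/7 * x $ 1 * y $ 2 - 10/7 * x $ 2 * y $ 1 - 6/7 * x $ 2 * y $ 2,
      6/7 * x $ 1 * y $ 1 + x $ 2 * y $ 1,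
      - 6 * x $ 1 * y $ 3 - 11 * x $ 1 * y $ 4 - 7 * x $ 2 * y $ 3 - 10 * x $ 2 * y $ 4
        - 6 * x $ 3 * y $ 1 - 6 * x $ 3 * y $ 2 - 10 * x $ 4 * y $ 1 - 10 * x $ 4 * y $ 2,
      5/3 * x $ 1 * y $ 4 + x $ 2 * y $ 4 + x $ 3 * y $ 1 + 5/3 * x $ 4 * y $ 1]"
| "connection6 L5_4_A1 x y = vector
     [0, 0, - x $ 4 * y $ 4, - x $ 1 * y $ 2, x $ 4 * y $ 1, - x $ 1 * y $ 5]"
| "connection6 L6_16 x y = vector
     [0, 0, - x $ 1 * y $ 2, x $ 3 * y $ 1, x $ 3 * y $ 2 - x $ 3 * y $ 3, - x $ 1 * y $ 4]"

text \<open>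
  The first simplification expands the quantifiers over generators and must precede the use of
  \<open>coordinates\<close>, which would turn membership in a set of generators into equations between entries.
\<close>

lemma bilag_connection_example2: "bilag_connection (example2 e) (connection2 e)"
  by (cases e; simp; intro bilag_connection_mk_bilagI; simp?)
     (simp_all add: coordinates algebra_simps linear_iff)

lemma bilag_connection_example4: "bilag_connection (example4 e) (connection4 e)"
  by (cases e; simp; intro bilag_connection_mk_bilagI; simp?)
     (simp_all add: coordinates algebra_simps linear_iff)

lemma bilag_connection_example6: "bilag_connection (example6 e) (connection6 e)"
  by (cases e; simp; intro bilag_connection_mk_bilagI; simp?)
     (simp_all add: coordinates algebra_simps add_divide_distrib linear_iff)

lemma nilpotent_example2: "nilpotent_lie_algebra (bracket (example2 e))"
proof (rule nilpotentI)
  show "lie_algebra (bracket (example2 e))"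
    using bilag_connection_example2 by (rule bilag_connection.lie)
  show "foldr (bracket (example2 e)) xs y = 0" if "length xs = 1" for xs y
    using that by (cases e) (auto simp: length_Suc_conv mk_bilag_def coordinates)
qed

lemma nilpotent_example4: "nilpotent_lie_algebra (bracket (example4 e))"
proof (rule nilpotentI)
  show "lie_algebra (bracket (example4 e))"
    using bilag_connection_example4 by (rule bilag_connection.lie)
  show "foldr (bracket (example4 e)) xs y = 0" if "length xs = 2" for xs y
    using that by (cases e) (auto simp: numeral_eq_Suc length_Suc_conv mk_bilag_def coordinates)
qed

text \<open>
  The bound 4 is attained on \<^const>\<open>L5_4_A1\<close> and \<^const>\<open>L6_16\<close>, which have nilpotency class 4.
\<close>

lemma nilpotent_example6: "nilpotent_lie_algebra (bracket (example6 e))"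
proof (rule nilpotentI)
  show "lie_algebra (bracket (example6 e))"
    using bilag_connection_example6 by (rule bilag_connection.lie)
  fix xs :: "(real ^ 6) list" and y
  assume "length xs = 4"
  then obtain a b c d where "xs = [a, b, c, d]"
    by (auto simp: numeral_eq_Suc length_Suc_conv)
  then show "foldr (bracket (example6 e)) xs y = 0"
    by (cases e) (simp_all add: mk_bilag_def coordinates)
qed

lemma flat_example2: "flat (example2 e)"
  unfolding flat_def bilag_connection.curvature_eq[OF bilag_connection_example2]
  by (cases e) (simp add: mk_bilag_def coordinates)

lemma flat_example4: "flat (example4 e)"
  unfolding flat_def bilag_connection.curvature_eq[OF bilag_connection_example4]
  by (cases e) (simp_all add: mk_bilag_def coordinates algebra_simps)

lemma flat_example6:
  assumes "e \<in> {A6, L3_A3, L5_2_A1, L6_1, L5_3_A1, L6_4, L6_5, L6_9}"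
  shows "flat (example6 e)"
  unfolding flat_def bilag_connection.curvature_eq[OF bilag_connection_example6]
  using assms by (auto simp: mk_bilag_def coordinates algebra_simps)

text \<open>
  On \<^const>\<open>L3_L3\<close> the operator \<open>R(E 2, E 1)\<close> vanishes; the witness there takes \<open>E 1\<close> and \<open>E 3\<close> from
  different summands of the Lie algebra.
\<close>

lemma curvature_example6_nonzero:
  assumes "e \<in> {L3_L3, L6_2, L6_6, L6_10, L6_11, L6_12, L5_4_A1, L6_16}"
  shows "curvature (example6 e) (E (if e = L3_L3 then 3 else 2)) (E 1) (E 1) \<noteq> 0"
  unfolding bilag_connection.curvature_eq[OF bilag_connection_example6]
  using assms by (auto simp: mk_bilag_def coordinates)

lemma flat_example6_iff:
  "flat (example6 e) \<longleftrightarrow> e \<in> {A6, L3_A3, L5_2_A1, L6_1, L5_3_A1, L6_4, L6_5, L6_9}"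
proof
  assume "flat (example6 e)"
  then have "e \<notin> {L3_L3, L6_2, L6_6, L6_10, L6_11, L6_12, L5_4_A1, L6_16}"
    using curvature_example6_nonzero unfolding flat_def by blast
  then show "e \<in> {A6, L3_A3, L5_2_A1, L6_1, L5_3_A1, L6_4, L6_5, L6_9}"
    by (cases e) auto
qed (rule flat_example6)

lemma ricci_flat_example2: "ricci_flat (example2 e)"
  using flat_example2 by (simp add: flat_def ricci_flat_def ricci_def trace_def matrix_def)

lemma ricci_flat_example4: "ricci_flat (example4 e)"
  using flat_example4 by (simp add: flat_def ricci_flat_def ricci_def trace_def matrix_def)

lemma ricci_flat_example6: "ricci_flat (example6 e)"
  unfolding ricci_flat_def ricci_def trace_def
    bilag_connection.curvature_eq[OF bilag_connection_example6]
  by (cases e) (simp_all add: matrix_def sum_6 mk_bilag_def coordinates algebra_simps)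

theorem theorem1p7:
  shows "(\<forall>e. nilpotent_lie_algebra (bracket (example2 e)) \<and> bi_lagrangian (example2 e))
    \<and> (\<forall>e. nilpotent_lie_algebra (bracket (example4 e)) \<and> bi_lagrangian (example4 e))
    \<and> (\<forall>e. nilpotent_lie_algebra (bracket (example6 e)) \<and> bi_lagrangian (example6 e))
    \<and> (\<forall>e. flat (example2 e)) \<and> (\<forall>e. flat (example4 e))
    \<and> {e. flat (example6 e)} = {A6, L3_A3, L5_2_A1, L6_1, L5_3_A1, L6_4, L6_5, L6_9}
    \<and> card {e. flat (example6 e)} = 8
    \<and> {e. \<not> flat (example6 e)} = {L3_L3, L6_2, L6_6, L6_10, L6_11, L6_12, L5_4_A1, L6_16}
    \<and> card {e. \<not> flat (example6 e)} = 8
    \<and> (\<forall>e. ricci_flat (example2 e)) \<and> (\<forall>e. ricci_flat (example4 e))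
    \<and> (\<forall>e. ricci_flat (example6 e))"
proof -
  have flat_set: "{e. flat (example6 e)} = {A6, L3_A3, L5_2_A1, L6_1, L5_3_A1, L6_4, L6_5, L6_9}"
    by (simp only: flat_example6_iff Collect_mem_eq)
  have nonflat_set:
    "{e. \<not> flat (example6 e)} = {L3_L3, L6_2, L6_6, L6_10, L6_11, L6_12, L5_4_A1, L6_16}"
  proof (rule set_eqI)
    show "e \<in> {e. \<not> flat (example6 e)} \<longleftrightarrow>
        e \<in> {L3_L3, L6_2, L6_6, L6_10, L6_11, L6_12, L5_4_A1, L6_16}" for e
      by (cases e) (simp_all add: flat_example6_iff)
  qed
  have card: "card {e. flat (example6 e)} = 8" "card {e. \<not> flat (example6 e)} = 8"
    unfolding flat_set nonflat_set by simp_all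
  show ?thesis
    by (intro conjI allI nilpotent_example2 nilpotent_example4 nilpotent_example6
      bilag_connection.bi_lagrangian[OF bilag_connection_example2]
      bilag_connection.bi_lagrangian[OF bilag_connection_example4]
      bilag_connection.bi_lagrangian[OF bilag_connection_example6]
      flat_example2 flat_example4 flat_set nonflat_set card
      ricci_flat_example2 ricci_flat_example4 ricci_flat_example6)
qed

end
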